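(* Let $X,Y\subseteq\mathbb{N}$, let $\rho=(\rho_1,\dots,\rho_m)$ be a composition of $n$, and let $s\ge0$. Write $[m]\setminus X=\{v_1,\dots,v_b\}$ and $a=\sum_{i=1}^b\rho_{v_i}$. Then $$P_{\rho,s}^{X,Y}=\binom{a}{\rho_{v_1},\dots,\rho_{v_b}}\sum_{r=0}^{n-a-s}(-1)^{n-a-s-r}\binom{a+r}{r}\binom{n+1}{n-a-s-r}\prod_{x\in X\cap[m]}\binom{r+\beta_{X,\rho,x}-\beta_{Y,\rho,x}}{\rho_x},$$ with the convention that $\binom{p}{q}=0$ if $p<0$.
   Context: A composition $\rho=(\rho_1,\dots,\rho_m)$ of $n$ has positive integer parts summing to $n$. $R(\rho)$ is the set of all words $w=w_1\cdots w_n$ that are rearrangements of $1^{\rho_1}\cdots m^{\rho_m}$. For $X,Y\subseteq\mathbb{N}$, $des_{X,Y}(w)=|\{i:w_i>w_{i+1},\ w_i\in X,\ w_{i+1}\in Y\}|$ and $P_{\rho,s}^{X,Y}=|\{w\in R(\rho):des_{X,Y}(w)=s\}|$. For $x\in[m]$ and $S\subseteq\mathbb{N}$, $\beta_{S,\rho,x}=\sum_{z\notin S,\ 1\le z<x}\rho_z$. An empty sum is $0$. *)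

theory Defs
  imports "HOL-Combinatorics.Combinatorics"
begin

text \<open>
  A composition is the list of its parts.  Lists are indexed from 0, so the part belonging to
  the letter \<open>i \<in> {1..m}\<close> is obtained with \<open>part\<close>.
\<close>

definition composition :: "nat \<Rightarrow> nat list \<Rightarrow> bool" where
  "composition n \<rho> \<longleftrightarrow> (\<forall>k\<in>set \<rho>. 0 < k) \<and> sum_list \<rho> = n"

definition part :: "nat list \<Rightarrow> nat \<Rightarrow> nat" where
  "part \<rho> i = \<rho> ! (i - 1)"

definition rearrangements :: "nat list \<Rightarrow> nat list set" where
  "rearrangements \<rho> =
     permutations_of_multiset
       (mset (concat (map (\<lambda>i. replicate (part \<rho> i) i) [1..<length \<rho> + 1])))"

definition des :: "nat set \<Rightarrow> nat set \<Rightarrow> nat list \<Rightarrow> nat" where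
  "des X Y w = card {i. i + 1 < length w \<and> w ! i > w ! (i + 1) \<and> w ! i \<in> X \<and> w ! (i + 1) \<in> Y}"

definition P :: "nat set \<Rightarrow> nat set \<Rightarrow> nat list \<Rightarrow> nat \<Rightarrow> nat" where
  "P X Y \<rho> s = card {w \<in> rearrangements \<rho>. des X Y w = s}"

definition \<beta> :: "nat set \<Rightarrow> nat list \<Rightarrow> nat \<Rightarrow> nat" where
  "\<beta> S \<rho> x = (\<Sum>z\<in>{z. 1 \<le> z \<and> z < x \<and> z \<notin> S}. part \<rho> z)"

text \<open>The division is exact.\<close>

definition multinomial :: "('a \<Rightarrow> nat) \<Rightarrow> 'a set \<Rightarrow> nat" where
  "multinomial k A = fact (\<Sum>v\<in>A. k v) div (\<Prod>v\<in>A. fact (k v))"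

text \<open>
  The upper argument may be negative; the coefficient is then 0, which differs from the
  polynomial extension \<open>gchoose\<close>.
\<close>

definition binom :: "int \<Rightarrow> nat \<Rightarrow> nat" where
  "binom p q = (if p < 0 then 0 else nat p choose q)"

end

theory Submission
  imports Defs "HOL-Computational_Algebra.Formal_Power_Series"
begin

text \<open>
  Add r bars to the words of R(\<rho>), a bar being a letter 0 that is smaller than all other letters and
  belongs to Y but not to X.  Call a word good if every letter of X in it is immediately followed by
  a smaller letter of Y.

  A word w of length n with d letters of X that are not tops of descents counted by des needs
  at least one bar after each of these d letters, while the other bars can go to any of the n + 1
  gaps.  Hence the numbers of good words with r bars over w have the generating function
  \<open>t ^ d / (1 - t) ^ (n + 1)\<close>.

  On the other hand the good words can be built by arranging the bars and the letters outside X
  arbitrarily and inserting the letters of X in increasing order.  The number of places for a new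
  letter x depends only on the content of the word, not on the word, which gives the product of
  binomial coefficients.  Multiplying by \<open>(1 - t) ^ (n + 1)\<close> and comparing coefficients yields the
  formula.
\<close>

section \<open>Good words and the deletion of all copies of one letter\<close>

definition admissible :: "'a::linorder set \<Rightarrow> 'a set \<Rightarrow> 'a \<Rightarrow> 'a list \<Rightarrow> bool" where
  "admissible X Y c w \<longleftrightarrow> (c \<in> X \<longrightarrow> w \<noteq> [] \<and> hd w < c \<and> hd w \<in> Y)"

fun good :: "'a::linorder set \<Rightarrow> 'a set \<Rightarrow> 'a list \<Rightarrow> bool" where
  "good X Y [] \<longleftrightarrow> True"
| "good X Y (c # w) \<longleftrightarrow> admissible X Y c w \<and> good X Y w"

text \<open>This is the exponent \<open>d\<close> of the generating function: each letter counted
  here needs a bar right behind it.\<close>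

fun deficiency :: "'a::linorder set \<Rightarrow> 'a set \<Rightarrow> 'a list \<Rightarrow> nat" where
  "deficiency X Y [] = 0"
| "deficiency X Y (c # w) = deficiency X Y w + (if admissible X Y c w then 0 else 1)"

text \<open>The fibre over \<open>w\<close> of deleting \<open>z\<close>, restricted to good words.
  Only \<open>u\<close> has to be good: a bad \<open>w\<close> can be repaired by bars.\<close>

definition insertions :: "'a::linorder set \<Rightarrow> 'a set \<Rightarrow> 'a \<Rightarrow> nat \<Rightarrow> 'a list \<Rightarrow> 'a list set" where
  "insertions X Y z r w = {u. good X Y u \<and> filter (\<lambda>c. c \<noteq> z) u = w \<and> count (mset u) z = r}"

lemma mset_insertion:
  assumes "u \<in> insertions X Y z r w"
  shows "mset u = mset w + replicate_mset r z"
proof -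
  have "mset u = filter_mset (\<lambda>c. c \<noteq> z) (mset u) + replicate_mset (count (mset u) z) z"
    by (rule multiset_eqI) auto
  then show ?thesis
    using assms by (auto simp: insertions_def)
qed

lemma finite_insertions [simp]: "finite (insertions X Y z r w)"
proof (rule finite_subset)
  show "insertions X Y z r w \<subseteq> permutations_of_multiset (mset w + replicate_mset r z)"
    by (auto simp: permutations_of_multiset_def dest: mset_insertion)
qed auto

text \<open>Admissibility depends only on the head of the following word, and a head other than
  \<open>z\<close> is inherited from \<open>w\<close>.\<close>

lemma hd_insertion:
  assumes "u \<in> insertions X Y z r w" "u \<noteq> []" "hd u \<noteq> z"
  shows "w \<noteq> []" "hd w = hd u"
  using assms by (cases u; auto simp: insertions_def)+

lemma insertion_not_Nil: "u \<in> insertions X Y z r w \<Longrightarrow> w \<noteq> [] \<Longrightarrow> u \<noteq> []"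
  by (auto simp: insertions_def)

text \<open>Deleting \<open>z\<close> maps the words on the left to arrangements of
  \<open>M\<close>; the sum runs over the disjoint fibres of this map.\<close>

lemma card_good_add_replicate:
  assumes "z \<notin># M"
  shows "card {u. good X Y u \<and> mset u = M + replicate_mset r z} =
    (\<Sum>w\<in>permutations_of_multiset M. card (insertions X Y z r w))"
proof -
  have "{u. good X Y u \<and> mset u = M + replicate_mset r z} =
      (\<Union>w\<in>permutations_of_multiset M. insertions X Y z r w)"
  proof (intro equalityI subsetI)
    fix u assume u: "u \<in> {u. good X Y u \<and> mset u = M + replicate_mset r z}"
    have "filter_mset (\<lambda>c. c \<noteq> z) (M + replicate_mset r z) = M"
      using assms by (intro multiset_eqI) (auto simp: not_in_iff)
    then have "filter (\<lambda>c. c \<noteq> z) u \<in> permutations_of_multiset M"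
      using u by (simp add: permutations_of_multiset_def)
    moreover have "u \<in> insertions X Y z r (filter (\<lambda>c. c \<noteq> z) u)"
      using u assms by (simp add: insertions_def not_in_iff)
    ultimately show "u \<in> (\<Union>w\<in>permutations_of_multiset M. insertions X Y z r w)"
      by blast
  next
    fix u assume "u \<in> (\<Union>w\<in>permutations_of_multiset M. insertions X Y z r w)"
    then show "u \<in> {u. good X Y u \<and> mset u = M + replicate_mset r z}"
      using mset_insertion
      by (fastforce simp: permutations_of_multiset_def insertions_def)
  qed
  moreover have "card (\<Union>w\<in>permutations_of_multiset M. insertions X Y z r w) =
      (\<Sum>w\<in>permutations_of_multiset M. card (insertions X Y z r w))"
    by (intro card_UN_disjoint) (simp_all, auto simp: insertions_def)
  ultimately show ?thesis
    by simp
qed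

section \<open>Inserting bars\<close>

definition insertion_fps :: "'a::linorder set \<Rightarrow> 'a set \<Rightarrow> 'a \<Rightarrow> 'a list \<Rightarrow> int fps" where
  "insertion_fps X Y z w = Abs_fps (\<lambda>r. int (card (insertions X Y z r w)))"

lemma insertion_fps_Nil:
  assumes "z \<notin> X"
  shows "insertion_fps X Y z [] * (1 - fps_X) = 1"
proof -
  have good: "good X Y (replicate r z)" for r
    using assms by (induction r) (auto simp: admissible_def)
  have "insertions X Y z r [] = {replicate r z}" for r
  proof (intro equalityI subsetI)
    fix u assume "u \<in> insertions X Y z r []"
    then have "mset u = replicate_mset r z"
      by (auto dest: mset_insertion)
    then have "length u = r" "\<And>c. c \<in> set u \<Longrightarrow> c = z"
      by (metis size_mset size_replicate_mset, metis in_replicate_mset set_mset_mset)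
    then show "u \<in> {replicate r z}"
      by (simp add: replicate_eqI)
  qed (auto simp: insertions_def good)
  then have "insertion_fps X Y z [] = Abs_fps (\<lambda>_. 1)"
    by (simp add: insertion_fps_def)
  then show ?thesis
    by (auto simp: fps_eq_iff algebra_simps)
qed

text \<open>Case split on the first letter. A bar may be prefixed freely because \<open>z\<close> is
  outside \<open>X\<close>, whereas \<open>c\<close> must accept what follows it.\<close>

lemma insertions_Cons_bar:
  assumes "z \<notin> X" "c \<noteq> z"
  shows "insertions X Y z r (c # w) =
    (if r = 0 then {} else (#) z ` insertions X Y z (r - 1) (c # w)) \<union>
    (#) c ` {u \<in> insertions X Y z r w. admissible X Y c u}" (is "?L = ?R")
proof (intro equalityI subsetI)
  fix u assume u: "u \<in> ?L"
  show "u \<in> ?R"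
  proof (cases u)
    case Nil
    then show ?thesis using u by (simp add: insertions_def)
  next
    case (Cons d v)
    then show ?thesis using u assms
      by (cases "d = z") (auto simp: insertions_def admissible_def)
  qed
next
  fix u assume "u \<in> ?R"
  then show "u \<in> ?L"
    using assms by (auto simp: insertions_def admissible_def split: if_splits)
qed

text \<open>A bar is a smaller letter of \<open>Y\<close>, so bars never spoil a letter
  \<open>c\<close> that is already admissible. A failing \<open>c\<close> forces one bar right
  behind it; the remaining bars are unrestricted by \<open>c\<close>.\<close>

lemma admissible_insertions_bar:
  assumes "z \<notin> X" "z \<in> Y" "z < c" "z \<notin> set w"
  shows "{u \<in> insertions X Y z r w. admissible X Y c u} =
    (if admissible X Y c w then insertions X Y z r w
     else if r = 0 then {} else (#) z ` insertions X Y z (r - 1) w)"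
proof (cases "admissible X Y c w")
  case True
  have "admissible X Y c u" if u: "u \<in> insertions X Y z r w" for u
  proof (cases "c \<in> X")
    case cX: True
    then have "u \<noteq> []" 
      using True insertion_not_Nil[OF u] by (auto simp: admissible_def)
    then show ?thesis
      using True cX assms hd_insertion[OF u] by (cases "hd u = z") (auto simp: admissible_def)
  qed (auto simp: admissible_def)
  then show ?thesis
    using True by auto
next
  case False
  then have cX: "c \<in> X"
    by (auto simp: admissible_def)
  show ?thesis
  proof (intro equalityI subsetI)
    fix u assume u: "u \<in> {u \<in> insertions X Y z r w. admissible X Y c u}"
    then have "u \<noteq> []" "hd u = z"
      using False cX hd_insertion[of u X Y z r w] by (simp_all add: admissible_def) metis
    then obtain v where "u = z # v"
      by (cases u) auto
    then show "u \<in> (if admissible X Y c w then insertions X Y z r w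
        else if r = 0 then {} else (#) z ` insertions X Y z (r - 1) w)"
      using u False by (auto simp: insertions_def)
  next
    fix u assume "u \<in> (if admissible X Y c w then insertions X Y z r w
        else if r = 0 then {} else (#) z ` insertions X Y z (r - 1) w)"
    then show "u \<in> {u \<in> insertions X Y z r w. admissible X Y c u}"
      using False cX assms by (auto simp: insertions_def admissible_def split: if_splits)
  qed
qed

text \<open>Words starting with a bar contribute \<open>fps_X\<close> times the series itself, which
  moves to the left as the factor \<open>1 - fps_X\<close>; a forced bar contributes
  \<open>fps_X\<close>.\<close>

lemma insertion_fps_Cons:
  assumes "z \<notin> X" "z \<in> Y" "z < c" "z \<notin> set w"
  shows "insertion_fps X Y z (c # w) * (1 - fps_X) =
    (if admissible X Y c w then 1 else fps_X) * insertion_fps X Y z w"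
proof -
  have "int (card (insertions X Y z r (c # w))) =
      (if r = 0 then 0 else int (card (insertions X Y z (r - 1) (c # w)))) +
      (if admissible X Y c w then int (card (insertions X Y z r w))
       else if r = 0 then 0 else int (card (insertions X Y z (r - 1) w)))" for r
  proof -
    have "card (insertions X Y z r (c # w)) =
        card (if r = 0 then {} else (#) z ` insertions X Y z (r - 1) (c # w)) +
        card ((#) c ` {u \<in> insertions X Y z r w. admissible X Y c u})"
      using assms by (subst insertions_Cons_bar, simp, simp, intro card_Un_disjoint) auto
    then show ?thesis
      using admissible_insertions_bar[OF assms, of r] by (auto simp: card_image)
  qed
  then have "insertion_fps X Y z (c # w) = fps_X * insertion_fps X Y z (c # w) +
      (if admissible X Y c w then 1 else fps_X) * insertion_fps X Y z w"
    by (auto simp: fps_eq_iff insertion_fps_def)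
  then show ?thesis
    by (simp add: algebra_simps)
qed

text \<open>Each letter supplies one factor \<open>1 - fps_X\<close> and the empty word one more,
  which matches the gaps of \<open>w\<close>.\<close>

lemma insertion_fps_eq:
  assumes "z \<notin> X" "z \<in> Y" "\<And>c. c \<in> set w \<Longrightarrow> z < c"
  shows "insertion_fps X Y z w * (1 - fps_X) ^ (length w + 1) = fps_X ^ deficiency X Y w"
  using assms(3)
proof (induction w)
  case Nil
  show ?case using insertion_fps_Nil[OF assms(1)] by simp
next
  case (Cons c w)
  have "insertion_fps X Y z (c # w) * (1 - fps_X) ^ (length (c # w) + 1) =
      insertion_fps X Y z (c # w) * (1 - fps_X) * (1 - fps_X) ^ (length w + 1)"
    by (simp add: mult.assoc)
  also have "\<dots> = (if admissible X Y c w then 1 else fps_X) *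
      (insertion_fps X Y z w * (1 - fps_X) ^ (length w + 1))"
    using Cons.prems assms by (subst insertion_fps_Cons) (force simp: mult.assoc)+
  also have "\<dots> = fps_X ^ deficiency X Y (c # w)"
    using Cons by simp
  finally show ?case .
qed

section \<open>Inserting the largest letter of X\<close>

text \<open>A leading \<open>x\<close> must be followed by a smaller letter, hence not by another
  \<open>x\<close>, and that letter is the head of \<open>w\<close>. So the front takes at most one
  copy, exactly when \<open>x\<close> is admissible there.\<close>

lemma card_insertions_max:
  assumes "x \<in> X" "x \<notin> set w"
  shows "card (insertions X Y x k w) =
    card {u \<in> insertions X Y x k w. u = [] \<or> hd u \<noteq> x} +
    (if admissible X Y x w \<and> k > 0
     then card {u \<in> insertions X Y x (k - 1) w. u = [] \<or> hd u \<noteq> x} else 0)"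
proof -
  let ?J = "\<lambda>k. {u \<in> insertions X Y x k w. u = [] \<or> hd u \<noteq> x}"
  have "insertions X Y x k w = ?J k \<union> 
      (if admissible X Y x w \<and> k > 0 then (#) x ` ?J (k - 1) else {})" (is "?L = ?R")
  proof (intro equalityI subsetI)
    fix u assume u: "u \<in> ?L"
    show "u \<in> ?R"
    proof (cases "u = [] \<or> hd u \<noteq> x")
      case False
      then obtain v where v: "u = x # v"
        by (cases u) auto
      then have "v \<in> insertions X Y x (k - 1) w" "k > 0" "v \<noteq> []" "hd v < x" "hd v \<in> Y"
        using u assms by (auto simp: insertions_def admissible_def)
      moreover from this have "admissible X Y x w"
        using hd_insertion[of v X Y x "k - 1" w] by (auto simp: admissible_def)
      ultimately show ?thesis
        using v by auto
    qed (use u in simp)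
  next
    fix u assume u: "u \<in> ?R"
    show "u \<in> ?L"
    proof (cases "u \<in> ?J k")
      case False
      with u obtain v where v: "u = x # v" "admissible X Y x w" "k > 0" "v \<in> ?J (k - 1)"
        by (auto split: if_splits)
      then have "v \<noteq> []" "hd v \<noteq> x" "hd w = hd v"
        using assms insertion_not_Nil[of v X Y x "k - 1" w] hd_insertion[of v X Y x "k - 1" w]
        by (auto simp: admissible_def)
      then have "admissible X Y x v"
        using v assms by (auto simp: admissible_def)
      then show ?thesis
        using v by (auto simp: insertions_def)
    qed simp
  qed
  then have "card (insertions X Y x k w) = card \<dots>"
    by (rule arg_cong)
  also have "\<dots> = card (?J k) +
      card (if admissible X Y x w \<and> k > 0 then (#) x ` ?J (k - 1) else {})"
    by (intro card_Un_disjoint) auto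
  finally show ?thesis
    by (simp add: card_image)
qed

text \<open>If \<open>c\<close> is in \<open>X\<close>, the place right behind it is blocked, since
  \<open>x\<close> exceeds \<open>c\<close>. If \<open>c\<close> is outside \<open>X\<close>,
  anything may follow it.\<close>

lemma card_insertions_max_Cons:
  assumes "c \<in> X \<Longrightarrow> c < x" "c \<noteq> x" "good X Y (c # w)"
  shows "card {u \<in> insertions X Y x k (c # w). u = [] \<or> hd u \<noteq> x} =
    (if c \<in> X then card {u \<in> insertions X Y x k w. u = [] \<or> hd u \<noteq> x}
     else card (insertions X Y x k w))"
proof -
  let ?J = "{u \<in> insertions X Y x k w. u = [] \<or> hd u \<noteq> x}"
  have "{u \<in> insertions X Y x k (c # w). u = [] \<or> hd u \<noteq> x} =
      (#) c ` (if c \<in> X then ?J else insertions X Y x k w)" (is "?L = ?R")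
  proof (intro equalityI subsetI)
    fix u assume u: "u \<in> ?L"
    then obtain v where v: "u = c # v"
      using hd_insertion[of u X Y x k "c # w"] insertion_not_Nil[of u X Y x k "c # w"]
      by (cases u) auto
    then show "u \<in> ?R"
      using u assms by (auto simp: insertions_def admissible_def)
  next
    fix u assume u: "u \<in> ?R"
    then obtain v where v: "u = c # v" "v \<in> insertions X Y x k w" "c \<in> X \<Longrightarrow> v \<in> ?J"
      by (auto split: if_splits)
    have "admissible X Y c v"
    proof (cases "c \<in> X")
      case True
      then show ?thesis
        using assms v(3) insertion_not_Nil[of v X Y x k w] hd_insertion[of v X Y x k w]
        by (auto simp: admissible_def)
    qed (simp add: admissible_def)
    then show "u \<in> ?L"
      using assms v by (auto simp: insertions_def)
  qed
  then show ?thesis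
    by (simp add: card_image)
qed

text \<open>
  A copy of x may be placed in front of any smaller letter of Y, except where it would separate a
  letter of X from its successor.  Each letter of X present blocks exactly one of these places.
\<close>

lemma card_insertions_max_eq:
  assumes "x \<in> X" "x \<notin> set w" "\<And>c. c \<in> set w \<Longrightarrow> c \<in> X \<Longrightarrow> c < x" "good X Y w"
  obtains p where "p + size {#c \<in># mset w. c \<in> X#} = size {#c \<in># mset w. c \<in> Y \<and> c < x#}"
    and "\<And>k. card (insertions X Y x k w) = p choose k"
proof -
  let ?J = "\<lambda>w k. {u \<in> insertions X Y x k w. u = [] \<or> hd u \<noteq> x}"
  let ?e = "\<lambda>w. if admissible X Y x w then 1 else 0 :: nat"
  \<comment> \<open>Pascal's rule: an available front place adds one to the number of
    places.\<close>
  have step: "card (insertions X Y x k w) = (q + ?e w) choose k"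
    if "x \<notin> set w" "\<And>k. card (?J w k) = q choose k" for w q k
  proof (cases k)
    case 0
    then show ?thesis
      using that card_insertions_max[OF assms(1) that(1), of Y k] by simp
  next
    case (Suc j)
    then show ?thesis
      using that card_insertions_max[OF assms(1) that(1), of Y k] by simp
  qed
  \<comment> \<open>Here \<open>q\<close> counts the available places other than the front of
    \<open>w\<close>, which \<open>?e w\<close> accounts for.\<close>
  have "\<exists>q. q + ?e w + size {#c \<in># mset w. c \<in> X#} = size {#c \<in># mset w. c \<in> Y \<and> c < x#} \<and>
      (\<forall>k. card (?J w k) = q choose k)"
    using assms(2-4)
  proof (induction w)
    case Nil
    have "?J [] k = (if k = 0 then {[]} else {})" for k
    proof -
      have "u = []" if "u \<in> ?J [] k" for u
        using that hd_insertion(1)[of u X Y x k "[]"] by auto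
      moreover have "[] \<in> ?J [] k \<longleftrightarrow> k = 0"
        by (auto simp: insertions_def)
      ultimately show ?thesis
        by auto
    qed
    then have "card (?J [] k) = 0 choose k" for k
      by (simp add: binomial_eq_0)
    then show ?case
      using assms(1) by (intro exI[of _ 0]) (simp add: admissible_def)
  next
    case (Cons c w)
    then obtain q where q: "q + ?e w + size {#c \<in># mset w. c \<in> X#} =
        size {#c \<in># mset w. c \<in> Y \<and> c < x#}" "\<And>k. card (?J w k) = q choose k"
      by auto
    have J: "card (?J (c # w) k) =
        (if c \<in> X then card (?J w k) else card (insertions X Y x k w))" for k
      using Cons.prems by (intro card_insertions_max_Cons) auto
    show ?case
    proof (cases "c \<in> X")
      case True
      \<comment> \<open>The successor of \<open>c\<close> lies in \<open>Y\<close> below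
        \<open>c\<close>, hence below \<open>x\<close>, so \<open>?e w\<close> is 1. Blocking this
        place keeps \<open>q\<close> unchanged and balances the new letter of
        \<open>X\<close>.\<close>
      moreover from True have "admissible X Y x w"
        using Cons.prems by (force simp: admissible_def)
      ultimately show ?thesis
        using q J assms(1) by (intro exI[of _ q]) (auto simp: admissible_def)
    next
      case False
      then have "card (?J (c # w) k) = (q + ?e w) choose k" for k
        using J step[of w q k] Cons.prems q(2) by simp
      then show ?thesis
        using q(1) False assms(1) by (intro exI[of _ "q + ?e w"]) (auto simp: admissible_def)
    qed
  qed
  then obtain q where "q + ?e w + size {#c \<in># mset w. c \<in> X#} =
      size {#c \<in># mset w. c \<in> Y \<and> c < x#}" "\<And>k. card (?J w k) = q choose k"
    by auto
  then show thesis
    using step[OF assms(2)] by (intro that[of "q + ?e w"]) auto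
qed

text \<open>A letter of \<open>X\<close> that is at most \<open>x\<close> has a strictly smaller
  successor in a good word, so this successor is not \<open>x\<close> and survives the
  deletion.\<close>

lemma good_filter_max:
  assumes "good X Y u" "\<And>c. c \<in> set u \<Longrightarrow> c \<in> X \<Longrightarrow> c \<le> x"
  shows "good X Y (filter (\<lambda>c. c \<noteq> x) u)"
  using assms
proof (induction u)
  case (Cons c u)
  then show ?case
    by (cases u) (force simp: admissible_def)+
qed simp

text \<open>All good arrangements of \<open>M\<close> admit the same number of insertions, bad ones
  admit none. A negative upper argument of \<open>binom\<close> occurs only if \<open>M\<close> has
  no good arrangement, so both sides are 0.\<close>

lemma card_good_add_max:
  assumes "x \<in> X" "x \<notin># M" "\<And>c. c \<in># M \<Longrightarrow> c \<in> X \<Longrightarrow> c < x"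
  shows "card {u. good X Y u \<and> mset u = M + replicate_mset k x} =
    card {u. good X Y u \<and> mset u = M} *
    binom (int (size {#c \<in># M. c \<in> Y \<and> c < x#}) - int (size {#c \<in># M. c \<in> X#})) k"
    (is "_ = _ * ?b")
proof -
  have "card (insertions X Y x k w) = (if good X Y w then ?b else 0)"
    if w: "w \<in> permutations_of_multiset M" for w
  proof (cases "good X Y w")
    case True
    have M: "mset w = M"
      using w by (simp add: permutations_of_multiset_def)
    obtain p where p: "p + size {#c \<in># mset w. c \<in> X#} = size {#c \<in># mset w. c \<in> Y \<and> c < x#}"
      "card (insertions X Y x k w) = p choose k"
      using card_insertions_max_eq[of x X w Y] assms True M by (metis set_mset_mset)
    then have "int (size {#c \<in># M. c \<in> Y \<and> c < x#}) - int (size {#c \<in># M. c \<in> X#}) = int p"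
      unfolding M by linarith
    then show ?thesis
      using p True by (simp add: binom_def)
  next
    case False
    have "insertions X Y x k w = {}"
    proof (rule equals0I)
      fix u assume u: "u \<in> insertions X Y x k w"
      have "c \<le> x" if "c \<in> set u" "c \<in> X" for c
      proof (cases "c = x")
        case False
        then have "c \<in> set w"
          using u that by (auto simp: insertions_def)
        then show ?thesis
          using assms(3)[of c] that w by (auto simp: permutations_of_multiset_def)
      qed simp
      then show False
        using False u good_filter_max[of X Y u x] by (auto simp: insertions_def)
    qed
    then show ?thesis
      using False by simp
  qed
  then have "card {u. good X Y u \<and> mset u = M + replicate_mset k x} =
      (\<Sum>w\<in>permutations_of_multiset M. if good X Y w then ?b else 0)"
    using card_good_add_replicate[OF assms(2)] by simp
  also have "\<dots> = (\<Sum>w\<in>{w \<in> permutations_of_multiset M. good X Y w}. ?b)"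
    by (intro sum.inter_filter[symmetric]) simp
  also have "\<dots> = card {u. good X Y u \<and> mset u = M} * ?b"
    by (simp add: permutations_of_multiset_def conj_commute)
  finally show ?thesis .
qed

section \<open>Counting good words\<close>

definition content :: "('a \<Rightarrow> nat) \<Rightarrow> 'a set \<Rightarrow> 'a multiset" where
  "content f A = (\<Sum>v\<in>A. replicate_mset (f v) v)"

lemma count_content: "finite A \<Longrightarrow> count (content f A) v = (if v \<in> A then f v else 0)"
  by (simp add: content_def count_sum if_distrib cong: if_cong)

lemma set_content: "finite A \<Longrightarrow> set_mset (content f A) = {v \<in> A. f v > 0}"
  by (auto simp: set_mset_def count_content split: if_splits)

lemma filter_content: "finite A \<Longrightarrow> filter_mset Q (content f A) = content f {v \<in> A. Q v}"
  by (rule multiset_eqI) (auto simp: count_content)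

lemma size_content: "size (content f A) = (\<Sum>v\<in>A. f v)"
  by (simp add: content_def size_multiset_sum)

lemma content_insert:
  "finite A \<Longrightarrow> v \<notin> A \<Longrightarrow> content f (insert v A) = content f A + replicate_mset (f v) v"
  by (simp add: content_def)

text \<open>Counting the arrangements also shows that the division in \<open>multinomial\<close> is
  exact.\<close>

lemma
  assumes "finite A"
  shows multinomial_mult_prod: "multinomial f A * (\<Prod>v\<in>A. fact (f v)) = fact (\<Sum>v\<in>A. f v)"
    and card_permutations_content: "card (permutations_of_multiset (content f A)) = multinomial f A"
proof -
  have "(\<Prod>v\<in>set_mset (content f A). fact (count (content f A) v)) = (\<Prod>v\<in>A. fact (f v) :: nat)"
    using assms by (intro prod.mono_neutral_cong_left) (auto simp: set_content count_content)
  then show "multinomial f A * (\<Prod>v\<in>A. fact (f v)) = fact (\<Sum>v\<in>A. f v)"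
    and "card (permutations_of_multiset (content f A)) = multinomial f A"
    using card_permutations_of_multiset[of "content f A"]
    by (simp_all add: multinomial_def size_content)
qed

text \<open>Used with the bars as \<open>z\<close>, this produces the factor
  \<open>(a + r) choose r\<close>.\<close>

lemma multinomial_insert:
  assumes "finite A" "z \<notin> A"
  shows "multinomial f (insert z A) = ((\<Sum>v\<in>A. f v) + f z choose f z) * multinomial f A"
proof -
  let ?p = "\<Prod>v\<in>A. fact (f v) :: nat"
  have "multinomial f (insert z A) * (fact (f z) * ?p) = fact ((\<Sum>v\<in>A. f v) + f z)"
    using multinomial_mult_prod[of "insert z A" f] assms by (simp add: add.commute)
  also have "\<dots> = ((\<Sum>v\<in>A. f v) + f z choose f z) * fact (f z) * fact (\<Sum>v\<in>A. f v)"
    using binomial_fact_lemma[of "f z" "(\<Sum>v\<in>A. f v) + f z"] by (simp add: ac_simps)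
  also have "\<dots> = ((\<Sum>v\<in>A. f v) + f z choose f z) * multinomial f A * (fact (f z) * ?p)"
    by (simp flip: multinomial_mult_prod[OF assms(1)])
  finally show ?thesis
    by (simp add: assms(1))
qed

text \<open>Words over \<open>V\<close> alone are all good. The letters of \<open>A\<close> are then
  added in increasing order, so the letters of \<open>X\<close> already present when
  \<open>x\<close> arrives are exactly the smaller elements of \<open>A\<close>.\<close>

lemma card_good_content:
  assumes "finite V" "V \<inter> X = {}" "finite A" "A \<subseteq> X"
  shows "card {u. good X Y u \<and> mset u = content f (V \<union> A)} =
    multinomial f V *
    (\<Prod>x\<in>A. binom (int (\<Sum>z\<in>{z \<in> V \<union> A. z \<in> Y \<and> z < x}. f z) -
                    int (\<Sum>z\<in>{z \<in> A. z < x}. f z)) (f x))"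
  using assms(3,4)
proof (induction A rule: finite_linorder_max_induct)
  case empty
  have "good X Y u" if "set u \<inter> X = {}" for u
    using that by (induction u) (auto simp: admissible_def)
  moreover have "set u \<inter> X = {}" if "mset u = content f V" for u
    using arg_cong[OF that, of set_mset] assms by (auto simp: set_content)
  ultimately have "{u. good X Y u \<and> mset u = content f (V \<union> {})} =
      permutations_of_multiset (content f V)"
    by (auto simp: permutations_of_multiset_def)
  then show ?case
    using card_permutations_content[OF assms(1)] by simp
next
  case (insert x A)
  let ?B = "\<lambda>A x. binom (int (\<Sum>z\<in>{z \<in> V \<union> A. z \<in> Y \<and> z < x}. f z) -
                    int (\<Sum>z\<in>{z \<in> A. z < x}. f z)) (f x)"
  have fin: "finite (V \<union> A)" and xV: "x \<notin> V \<union> A" and xX: "x \<in> X"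
    using insert assms by auto
  have "card {u. good X Y u \<and> mset u = content f (V \<union> insert x A)} =
      card {u. good X Y u \<and> mset u = content f (V \<union> A) + replicate_mset (f x) x}"
    using content_insert[OF fin xV] by simp
  also have "\<dots> = card {u. good X Y u \<and> mset u = content f (V \<union> A)} *
      binom (int (\<Sum>z\<in>{z \<in> V \<union> A. z \<in> Y \<and> z < x}. f z) - int (\<Sum>z\<in>{z \<in> V \<union> A. z \<in> X}. f z)) (f x)"
    using insert xV xX assms fin
    by (subst card_good_add_max) (auto simp: set_content filter_content size_content)
  also have "{z \<in> V \<union> A. z \<in> X} = {z \<in> A. z < x}"
    using insert assms by auto
  also have "card {u. good X Y u \<and> mset u = content f (V \<union> A)} = multinomial f V * (\<Prod>y\<in>A. ?B A y)"
    using insert by simp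
  \<comment> \<open>The factors of earlier letters look only below those letters, so the larger
    \<open>x\<close> leaves them unchanged.\<close>
  also have "(\<Prod>y\<in>A. ?B A y) = (\<Prod>y\<in>A. ?B (insert x A) y)"
  proof (intro prod.cong refl)
    fix y assume "y \<in> A"
    then have "{z \<in> V \<union> A. z \<in> Y \<and> z < y} = {z \<in> V \<union> insert x A. z \<in> Y \<and> z < y}"
      "{z \<in> A. z < y} = {z \<in> insert x A. z < y}"
      using insert.hyps by force+
    then show "?B A y = ?B (insert x A) y"
      by simp
  qed
  also have "?B A x = ?B (insert x A) x"
  proof -
    have "{z \<in> V \<union> A. z \<in> Y \<and> z < x} = {z \<in> V \<union> insert x A. z \<in> Y \<and> z < x}"
      "{z \<in> A. z < x} = {z \<in> insert x A. z < x}"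
      by auto
    then show ?thesis by simp
  qed
  finally show ?case
    using insert.hyps xV by (simp add: mult_ac)
qed

section \<open>Descents\<close>

lemma des_Cons:
  "des X Y (c # w) =
    des X Y w + (if w \<noteq> [] \<and> c \<in> X \<and> hd w < c \<and> hd w \<in> Y then 1 else 0)"
proof -
  let ?D = "\<lambda>w. {i. i + 1 < length w \<and> w ! i > w ! (i + 1) \<and> w ! i \<in> X \<and> w ! (i + 1) \<in> Y}"
  have "?D (c # w) =
      Suc ` ?D w \<union> (if w \<noteq> [] \<and> c \<in> X \<and> hd w < c \<and> hd w \<in> Y then {0} else {})" (is "_ = ?R")
  proof (rule set_eqI)
    fix i
    show "i \<in> ?D (c # w) \<longleftrightarrow> i \<in> ?R"
      by (cases i) (auto simp: hd_conv_nth)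
  qed
  moreover have "finite (?D w)"
    by (rule finite_subset[of _ "{..<length w}"]) auto
  ultimately show ?thesis
    by (auto simp: des_def card_image)
qed

text \<open>Every letter of \<open>X\<close> in \<open>w\<close> is either a counted descent top or
  deficient. Changing the status of 0 for the bars is harmless as \<open>w\<close> has no 0.\<close>

lemma deficiency_add_des:
  assumes "0 \<notin> set w"
  shows "deficiency (X - {0}) (insert 0 Y) w + des X Y w = size {#c \<in># mset w. c \<in> X#}"
  using assms
proof (induction w)
  case Nil
  show ?case by (simp add: des_def)
next
  case (Cons c w)
  have "w \<noteq> [] \<Longrightarrow> hd w \<noteq> 0"
    using Cons.prems by (cases w) auto
  then have "admissible (X - {0}) (insert 0 Y) c w \<longleftrightarrow>
      (c \<in> X \<longrightarrow> w \<noteq> [] \<and> c \<in> X \<and> hd w < c \<and> hd w \<in> Y)"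
    using Cons.prems by (auto simp: admissible_def)
  then show ?case
    using Cons by (simp add: des_Cons)
qed

section \<open>Contents of rearrangements and the comparison of coefficients\<close>

lemma rearrangements_eq:
  "rearrangements \<rho> = permutations_of_multiset (content (part \<rho>) {1..length \<rho>})"
proof -
  have "mset (concat (map (\<lambda>i. replicate (f i) i) xs)) = content f (set xs)" if "distinct xs"
    for f and xs :: "nat list"
    using that by (induction xs) (auto simp: content_def)
  moreover have "set [1..<length \<rho> + 1] = {1..length \<rho>}"
    by auto
  ultimately show ?thesis
    unfolding rearrangements_def by (metis distinct_upt)
qed

lemma sum_part: "(\<Sum>i\<in>{1..length \<rho>}. part \<rho> i) = sum_list \<rho>"
proof -
  have "(\<Sum>i\<in>{1..length \<rho>}. part \<rho> i) = (\<Sum>i<length \<rho>. \<rho> ! i)"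
    by (rule sum.reindex_bij_witness[of _ Suc "\<lambda>i. i - 1"]) (auto simp: part_def)
  then show ?thesis
    by (simp add: sum_list_sum_nth atLeast0LessThan)
qed

lemma one_minus_fps_X_power_nth:
  "fps_nth ((1 - fps_X :: int fps) ^ n) k = (-1) ^ k * int (n choose k)"
proof (induction n arbitrary: k)
  case 0
  then show ?case
    by (cases k) auto
next
  case (Suc n)
  then show ?case
    by (cases k) (simp_all add: left_diff_distrib ring_distribs)
qed

theorem theorem5p6:
  fixes X Y :: "nat set" and \<rho> :: "nat list" and n m s a :: nat
  assumes "composition n \<rho>"
    and "m = length \<rho>"
    and "a = (\<Sum>v\<in>{1..m} - X. part \<rho> v)"
  shows "int (P X Y \<rho> s) =
    int (multinomial (part \<rho>) ({1..m} - X)) *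
    (\<Sum>r\<in>{r. a + s + r \<le> n}.
       (-1) ^ (n - a - s - r) * int ((a + r) choose r) * int ((n + 1) choose (n - a - s - r)) *
       (\<Prod>x\<in>X \<inter> {1..m}.
          int (binom (int r + int (\<beta> X \<rho> x) - int (\<beta> Y \<rho> x)) (part \<rho> x))))"
proof -
  \<comment> \<open>The bar is the letter 0, so its membership is fixed whatever \<open>X\<close>
    and \<open>Y\<close> say about 0.\<close>
  let ?X = "X - {0}" and ?Y = "insert 0 Y" and ?V = "{1..m} - X" and ?A = "X \<inter> {1..m}"
  let ?M = "content (part \<rho>) {1..m}"
  let ?k = "deficiency ?X ?Y"
  let ?c = "multinomial (part \<rho>) ?V"
  let ?g = "\<lambda>r. ((a + r) choose r) *
    (\<Prod>x\<in>?A. binom (int r + int (\<beta> X \<rho> x) - int (\<beta> Y \<rho> x)) (part \<rho> x))"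
  define N where "N r = card {u. good ?X ?Y u \<and> mset u = ?M + replicate_mset r 0}" for r
  have sum_n: "(\<Sum>v\<in>{1..m}. part \<rho> v) = n"
    using assms sum_part by (simp add: composition_def)
  have R: "rearrangements \<rho> = permutations_of_multiset ?M"
    using rearrangements_eq assms by simp
  have w: "length w = n" "0 \<notin> set w" "?k w + des X Y w + a = n" "\<And>c. c \<in> set w \<Longrightarrow> 0 < c"
    if "w \<in> rearrangements \<rho>" for w
  proof -
    have M: "mset w = ?M"
      using that by (simp add: R permutations_of_multiset_def)
    show "length w = n"
      using arg_cong[OF M, of size] sum_n by (simp add: size_content)
    show pos: "0 < c" if "c \<in> set w" for c
      using that arg_cong[OF M, of set_mset] by (auto simp: set_content)
    then show w0: "0 \<notin> set w"
      by blast
    have "{1..m} = {v \<in> {1..m}. v \<in> X} \<union> ?V"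
      by auto
    then have "(\<Sum>v\<in>{v \<in> {1..m}. v \<in> X}. part \<rho> v) + a = n"
      using sum_n sum.union_disjoint[of "{v \<in> {1..m}. v \<in> X}" ?V "part \<rho>"] assms(3) by fastforce
    then show "?k w + des X Y w + a = n"
      using deficiency_add_des[OF w0, of X Y] by (simp add: M filter_content size_content)
  qed
  have N: "N r = ?c * ?g r" for r
  proof -
    \<comment> \<open>The override is essential: by truncated subtraction
      \<open>part \<rho> 0\<close> equals \<open>part \<rho> 1\<close>, not the number of
      bars.\<close>
    let ?f = "(part \<rho>)(0 := r)"
    have "insert 0 ?V \<union> ?A = insert 0 {1..m}"
      by auto
    moreover have "content ?f {1..m} = ?M"
      by (auto simp: content_def intro!: sum.cong)
    ultimately have "content ?f (insert 0 ?V \<union> ?A) = ?M + replicate_mset r 0"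
      by (simp add: content_insert)
    then have "N r = multinomial ?f (insert 0 ?V) *
        (\<Prod>x\<in>?A. binom (int (\<Sum>z\<in>{z \<in> insert 0 ?V \<union> ?A. z \<in> ?Y \<and> z < x}. ?f z) -
                       int (\<Sum>z\<in>{z \<in> ?A. z < x}. ?f z)) (?f x))"
      unfolding N_def by (subst card_good_content[symmetric]) auto
    moreover have "multinomial ?f (insert 0 ?V) = ((a + r) choose r) * ?c"
    proof -
      have "(\<Sum>v\<in>?V. ?f v) = a" "multinomial ?f ?V = ?c"
        using assms(3)
        by (auto simp: multinomial_def
            intro!: sum.cong prod.cong arg_cong2[of _ _ _ _ "(div)"] arg_cong[of _ _ fact])
      then show ?thesis
        by (simp add: multinomial_insert)
    qed
    moreover have "binom (int (\<Sum>z\<in>{z \<in> insert 0 ?V \<union> ?A. z \<in> ?Y \<and> z < x}. ?f z) -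
        int (\<Sum>z\<in>{z \<in> ?A. z < x}. ?f z)) (?f x) =
        binom (int r + int (\<beta> X \<rho> x) - int (\<beta> Y \<rho> x)) (part \<rho> x)" if x: "x \<in> ?A" for x
    proof -
      \<comment> \<open>The right side does not depend on \<open>S\<close>. Comparing
        \<open>X\<close> with \<open>Y\<close> turns the difference of sums inside the two sets into
        \<open>\<beta> X \<rho> x - \<beta> Y \<rho> x\<close>.\<close>
      have split: "(\<Sum>z\<in>{z. 1 \<le> z \<and> z < x \<and> z \<in> S}. part \<rho> z) + \<beta> S \<rho> x =
          (\<Sum>z\<in>{1..<x}. part \<rho> z)" for S
      proof -
        have "{1..<x} = {z. 1 \<le> z \<and> z < x \<and> z \<in> S} \<union> {z. 1 \<le> z \<and> z < x \<and> z \<notin> S}"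
          by auto
        then show ?thesis
          unfolding \<beta>_def by (subst sum.union_disjoint[symmetric]) auto
      qed
      have "{z \<in> insert 0 ?V \<union> ?A. z \<in> ?Y \<and> z < x} = insert 0 {z. 1 \<le> z \<and> z < x \<and> z \<in> Y}"
        using x by auto
      then have "(\<Sum>z\<in>{z \<in> insert 0 ?V \<union> ?A. z \<in> ?Y \<and> z < x}. ?f z) =
          r + (\<Sum>z\<in>{z. 1 \<le> z \<and> z < x \<and> z \<in> Y}. part \<rho> z)"
        by (auto intro!: sum.cong)
      moreover have "(\<Sum>z\<in>{z \<in> ?A. z < x}. ?f z) =
          (\<Sum>z\<in>{z. 1 \<le> z \<and> z < x \<and> z \<in> X}. part \<rho> z)"
        using x by (intro sum.cong) auto
      moreover have "?f x = part \<rho> x"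
        using x by simp
      ultimately show ?thesis
        using split[of X] split[of Y]
        by (intro arg_cong2[of _ _ _ _ binom]) linarith+
    qed
    ultimately show ?thesis
      by simp
  qed
  \<comment> \<open>The second count of \<open>N\<close>: group the good words by the rearrangement
    left after deleting the bars.\<close>
  have "(\<Sum>w\<in>rearrangements \<rho>. fps_X ^ ?k w) = Abs_fps (\<lambda>r. int (N r)) * (1 - fps_X) ^ (n + 1)"
  proof -
    have "int (N r) = (\<Sum>w\<in>rearrangements \<rho>. int (card (insertions ?X ?Y 0 r w)))" for r
      unfolding N_def R by (subst card_good_add_replicate) (auto simp: set_content)
    then have "Abs_fps (\<lambda>r. int (N r)) = (\<Sum>w\<in>rearrangements \<rho>. insertion_fps ?X ?Y 0 w)"
      by (simp add: fps_eq_iff fps_sum_nth insertion_fps_def)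
    then have "Abs_fps (\<lambda>r. int (N r)) * (1 - fps_X) ^ (n + 1) =
        (\<Sum>w\<in>rearrangements \<rho>. insertion_fps ?X ?Y 0 w * (1 - fps_X) ^ (n + 1))"
      by (simp only: sum_distrib_right)
    also have "\<dots> = (\<Sum>w\<in>rearrangements \<rho>. fps_X ^ ?k w)"
    proof (rule sum.cong)
      fix v assume "v \<in> rearrangements \<rho>"
      then show "insertion_fps ?X ?Y 0 v * (1 - fps_X) ^ (n + 1) = fps_X ^ ?k v"
        using w[of v] insertion_fps_eq[of 0 ?X ?Y v] by simp
    qed simp
    finally show ?thesis ..
  qed
  then have coeff: "(\<Sum>w\<in>rearrangements \<rho>. fps_nth (fps_X ^ ?k w) d) =
      (\<Sum>r=0..d. int (N r) * ((-1) ^ (d - r) * int ((n + 1) choose (d - r))))" for d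
    by (simp only: fps_sum_nth[symmetric] fps_mult_nth one_minus_fps_X_power_nth fps_nth_Abs_fps)
  show ?thesis
  proof (cases "a + s \<le> n")
    case True
    \<comment> \<open>Deficiency and descents add up to \<open>n - a\<close>, so \<open>s\<close>
      descents correspond to the coefficient at \<open>n - a - s\<close>.\<close>
    have "{w \<in> rearrangements \<rho>. des X Y w = s} = {w \<in> rearrangements \<rho>. n - a - s = ?k w}"
      using w(3) True by force
    then have "int (P X Y \<rho> s) = (\<Sum>w\<in>rearrangements \<rho>. if n - a - s = ?k w then 1 else 0)"
      by (simp add: P_def R sum.inter_filter[symmetric])
    also have "\<dots> = (\<Sum>w\<in>rearrangements \<rho>. fps_nth (fps_X ^ ?k w) (n - a - s))"
      by (simp add: fps_X_power_iff)
    also have "\<dots> = (\<Sum>r\<in>{r. a + s + r \<le> n}. int (?c * ?g r) *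
        ((-1) ^ (n - a - s - r) * int ((n + 1) choose (n - a - s - r))))"
      unfolding coeff N using True by (intro sum.cong) auto
    finally show ?thesis
      by (simp add: sum_distrib_left mult_ac)
  next
    case False
    \<comment> \<open>There are at most \<open>n - a\<close> descents, so both sides vanish.\<close>
    then have "{w \<in> rearrangements \<rho>. des X Y w = s} = {}"
      using w(3) by force
    moreover have "{r. a + s + r \<le> n} = {}"
      using False by auto
    ultimately show ?thesis
      by (simp only: P_def) simp
  qed
qed

end
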